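(* Let $R$ be a finite local ring with $|R|=q^n$ for some $n \geq 2$ and $R/J=GF(q)$. The following statements are equivalent. (1) $\mathrm{Prob}_x(R) = \frac{(q-1)(q^{n-2}+1)}{q^{2n-1}}$ for every $0 \neq x \in J$. (2) $\mathrm{Prob}_x(R) = \frac{q^{n-1}+q-2}{q^{n+1}}$ for every $0 \neq x \in J$. (3) $\mathrm{Prob}_0(R) = \frac{3q^{n-1}-q^{n-2}-1}{q^{2n-1}}$. (4) $R$ is a ring with $q^2$ elements.
   Context: Rings are associative with unity $1$, not necessarily commutative. $J=J(R)$ is the Jacobson radical of $R$, and $GF(q)$ is the finite field with $q$ elements ($R/J=GF(q)$ means isomorphic as rings). For a finite ring $R$ and $x \in R$, the multiplication probability is $\mathrm{Prob}_x(R)=\frac{|\{(a,b) \in R^2 : ab=x\}|}{|R|^2}$. *)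

theory Defs
  imports Complex_Main "HOL-Algebra.QuotRing"
begin

text \<open>
  The rings of HOL-Algebra's locale \<open>ring\<close> are associative with unity and not necessarily
  commutative. The library's \<open>ideal\<close> and \<open>maximalideal\<close> are two-sided, so the one-sided
  notions behind the Jacobson radical are introduced here.
\<close>

locale left_ideal = additive_subgroup I R + ring R for I and R (structure) +
  assumes left_closed: "\<lbrakk>a \<in> I; x \<in> carrier R\<rbrakk> \<Longrightarrow> x \<otimes> a \<in> I"

locale maximal_left_ideal = left_ideal +
  assumes proper: "I \<noteq> carrier R"
    and maximal: "\<lbrakk>left_ideal K R; I \<subseteq> K\<rbrakk> \<Longrightarrow> K = I \<or> K = carrier R"

text \<open>
  The intersection with the carrier only matters for the zero ring, which has no maximal
  left ideals.
\<close>

definition jacobson_radical :: "('a, 'm) ring_scheme \<Rightarrow> 'a set"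
  where "jacobson_radical R = carrier R \<inter> \<Inter> {I. maximal_left_ideal I R}"

locale local_ring = ring R for R (structure) +
  assumes unique_maximal_left_ideal: "\<exists>!I. maximal_left_ideal I R"

definition mult_prob :: "('a, 'm) ring_scheme \<Rightarrow> 'a \<Rightarrow> real"
  where "mult_prob R x =
    real (card {(a, b) \<in> carrier R \<times> carrier R. a \<otimes>\<^bsub>R\<^esub> b = x}) / real (card (carrier R)) ^ 2"

end

theory Submission
  imports Defs
begin

text \<open>
  Put \<open>r = |R|\<close> and \<open>m = |J|\<close>, so that \<open>r = q m\<close>. In a finite local ring the elements outside \<open>J\<close>
  are exactly the units. For \<open>x \<in> J\<close> a factorization \<open>x = a b\<close> therefore has exactly one unit
  factor, which determines the other factor, or has both factors in \<open>J\<close>. Hence there are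
  \<open>2 (r - m) + M x\<close> of them, where \<open>M x\<close> counts the factorizations inside \<open>J\<close>. Each of the
  probability conditions thus prescribes values of \<open>M\<close>, and each turns out to be equivalent
  to \<open>m = q\<close>, that is, to \<open>r = q\<^sup>2\<close>.

  The basic estimate concerns left annihilators. For \<open>0 \<noteq> b \<in> J\<close> the annihilator \<open>ann b\<close>
  contains no unit, so it lies in \<open>J\<close>. Since \<open>R b\<close> is contained in \<open>J\<close> and
  \<open>|R b| |ann b| = q m\<close>, the annihilator has at least \<open>q\<close> elements. If \<open>m = q\<close>, then
  \<open>ann b = J\<close> for all these \<open>b\<close>, so \<open>J J = 0\<close> and \<open>M\<close> vanishes except for \<open>M 0 = q\<^sup>2\<close>; this
  yields all three conditions. In general, summing over \<open>b \<in> J\<close> gives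
  \<open>M 0 \<ge> m + (m - 1) q\<close>. The converses are as follows.

  The first condition says \<open>M x = (q - 1) (q - m)\<close> for all nonzero \<open>x \<in> J\<close>. As \<open>M x \<ge> 0\<close>,
  it follows that \<open>m \<le> q\<close>.

  The second condition says \<open>M x = m (m - q)\<close> for all nonzero \<open>x \<in> J\<close>. The values of \<open>M\<close> on \<open>J\<close> sum to
  \<open>m\<^sup>2\<close>, and \<open>M 0 > m\<close>, so \<open>(m - 1) m (m - q) < m\<^sup>2 - m\<close> and \<open>m - q < 1\<close>.

  The third condition says that the estimate for \<open>M 0\<close> is an equality. Then every nonzero
  \<open>b \<in> J\<close> satisfies \<open>R b = J\<close>. If some product \<open>a b\<close> of elements of \<open>J\<close> were nonzero, then
  \<open>b \<in> J = R a b\<close>, which contradicts Nakayama's lemma. So \<open>J = ann b\<close> has \<open>q\<close> elements.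
\<close>

section \<open>Left ideals and left annihilators\<close>

context ring
begin

lemma left_ideal_intro:
  assumes "I \<subseteq> carrier R" "\<zero> \<in> I"
    and add: "\<And>a b. a \<in> I \<Longrightarrow> b \<in> I \<Longrightarrow> a \<oplus> b \<in> I"
    and mult: "\<And>a x. a \<in> I \<Longrightarrow> x \<in> carrier R \<Longrightarrow> x \<otimes> a \<in> I"
  shows "left_ideal I R"
proof -
  have "\<ominus> a \<in> I" if "a \<in> I" for a
  proof -
    have "(\<ominus> \<one>) \<otimes> a \<in> I"
      using mult[OF that, of "\<ominus> \<one>"] by simp
    moreover have "(\<ominus> \<one>) \<otimes> a = \<ominus> a"
      using that assms(1) l_minus[of \<one> a] by auto
    ultimately show ?thesis
      by simp
  qed
  then have "additive_subgroup I R"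
    using assms by (intro additive_subgroupI add.subgroupI) (auto simp: a_inv_def)
  then show ?thesis
    using mult ring_axioms by (simp add: left_ideal_def left_ideal_axioms_def)
qed

lemma left_ideal_principal:
  assumes "b \<in> carrier R"
  shows "left_ideal ((\<lambda>r. r \<otimes> b) ` carrier R) R"
proof (rule left_ideal_intro)
  show "\<zero> \<in> (\<lambda>r. r \<otimes> b) ` carrier R"
    using assms by (intro image_eqI[of _ _ \<zero>]) auto
next
  fix x y
  assume "x \<in> (\<lambda>r. r \<otimes> b) ` carrier R" "y \<in> (\<lambda>r. r \<otimes> b) ` carrier R"
  then obtain r s where "r \<in> carrier R" "s \<in> carrier R" "x = r \<otimes> b" "y = s \<otimes> b"
    by blast
  then show "x \<oplus> y \<in> (\<lambda>r. r \<otimes> b) ` carrier R"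
    using assms by (intro image_eqI[of _ _ "r \<oplus> s"]) (auto simp: l_distr)
next
  fix x y
  assume "x \<in> (\<lambda>r. r \<otimes> b) ` carrier R" "y \<in> carrier R"
  then obtain r where "r \<in> carrier R" "x = r \<otimes> b"
    by blast
  then show "y \<otimes> x \<in> (\<lambda>r. r \<otimes> b) ` carrier R"
    using assms \<open>y \<in> carrier R\<close> by (intro image_eqI[of _ _ "y \<otimes> r"]) (auto simp: m_assoc)
qed (use assms in auto)

text \<open>
  The left annihilator of an element \<open>b\<close> consists of those \<open>a\<close> with \<open>a \<otimes> b = \<zero>\<close>: it is the
  kernel of the right multiplication by \<open>b\<close>.
\<close>

definition left_annihilator :: "'a \<Rightarrow> 'a set"
  where "left_annihilator b = {a \<in> carrier R. a \<otimes> b = \<zero>}"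

text \<open>
  Right multiplication by \<open>b\<close> is additive, so the fibres over its image are the cosets of its
  kernel.
\<close>

lemma card_principal_times_left_annihilator:
  assumes fin: "finite (carrier R)" and b: "b \<in> carrier R"
  shows "card ((\<lambda>r. r \<otimes> b) ` carrier R) * card (left_annihilator b) = card (carrier R)"
proof -
  have fibre: "card {r \<in> carrier R. r \<otimes> b = y} = card (left_annihilator b)"
    if y: "y \<in> (\<lambda>r. r \<otimes> b) ` carrier R" for y
  proof -
    from y obtain s where s: "s \<in> carrier R" "y = s \<otimes> b"
      by (elim imageE)
    have "bij_betw (\<lambda>r. r \<oplus> s) (left_annihilator b) {r \<in> carrier R. r \<otimes> b = y}"
    proof (rule bij_betw_byWitness[where f' = "\<lambda>r. r \<ominus> s"])
      show "\<forall>a\<in>left_annihilator b. a \<oplus> s \<ominus> s = a"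
        using s by (auto simp: left_annihilator_def minus_eq a_assoc r_neg)
      show "\<forall>r\<in>{r \<in> carrier R. r \<otimes> b = y}. r \<ominus> s \<oplus> s = r"
        using s by (auto simp: minus_eq a_assoc l_neg)
      show "(\<lambda>r. r \<oplus> s) ` left_annihilator b \<subseteq> {r \<in> carrier R. r \<otimes> b = y}"
        using s b by (auto simp: left_annihilator_def l_distr)
      show "(\<lambda>r. r \<ominus> s) ` {r \<in> carrier R. r \<otimes> b = y} \<subseteq> left_annihilator b"
        using s b by (auto simp: left_annihilator_def minus_eq l_distr l_minus r_neg)
    qed
    then show ?thesis
      by (simp add: bij_betw_same_card)
  qed
  have "card (carrier R) = (\<Sum>y \<in> (\<lambda>r. r \<otimes> b) ` carrier R. card {r \<in> carrier R. r \<otimes> b = y})"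
    using sum.group[of "carrier R" "(\<lambda>r. r \<otimes> b) ` carrier R" "\<lambda>r. r \<otimes> b" "\<lambda>_. 1 :: nat"] fin by simp
  then show ?thesis
    using fibre by simp
qed

end

section \<open>Finite local rings\<close>

locale finite_local_ring = local_ring +
  assumes finite_carrier [simp]: "finite (carrier R)"
begin

abbreviation J :: "'a set"
  where "J \<equiv> jacobson_radical R"

lemma left_ideal_subset_carrier: "left_ideal I R \<Longrightarrow> I \<subseteq> carrier R"
  by (simp add: left_ideal_def additive_subgroup.a_subset)

text \<open>The unique maximal left ideal is the Jacobson radical.\<close>

lemma maximal_left_ideal_iff: "maximal_left_ideal I R \<longleftrightarrow> I = J"
proof -
  obtain M where M: "maximal_left_ideal M R" "\<And>I. maximal_left_ideal I R \<Longrightarrow> I = M"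
    using unique_maximal_left_ideal by blast
  have "{I. maximal_left_ideal I R} = {M}"
    using M by blast
  moreover have "M \<subseteq> carrier R"
    using M(1) by (simp add: maximal_left_ideal_def left_ideal_subset_carrier)
  ultimately have "J = M"
    by (simp add: jacobson_radical_def Int_absorb1)
  then show ?thesis
    using M by blast
qed

lemma left_ideal_J: "left_ideal J R" and J_proper: "J \<noteq> carrier R"
  using maximal_left_ideal_iff[of J]
  by (auto simp: maximal_left_ideal_def maximal_left_ideal_axioms_def)

lemma additive_subgroup_J: "additive_subgroup J R"
  using left_ideal_J by (simp add: left_ideal_def)

lemma J_subset: "J \<subseteq> carrier R"
  by (rule left_ideal_subset_carrier[OF left_ideal_J])

lemma J_closed: "a \<in> J \<Longrightarrow> a \<in> carrier R"
  using J_subset by blast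

lemma finite_J [simp]: "finite J"
  using finite_subset[OF J_subset] by simp

lemma zero_in_J [simp]: "\<zero> \<in> J"
  by (rule additive_subgroup.zero_closed[OF additive_subgroup_J])

lemma J_mult_left: "a \<in> J \<Longrightarrow> x \<in> carrier R \<Longrightarrow> x \<otimes> a \<in> J"
  by (rule left_ideal.left_closed[OF left_ideal_J])

lemma one_notin_J: "\<one> \<notin> J"
proof
  assume "\<one> \<in> J"
  then have "x \<in> J" if "x \<in> carrier R" for x
    using J_mult_left[of \<one> x] that by simp
  then show False
    using J_subset J_proper by blast
qed

lemma proper_left_ideal_subset_J:
  assumes "left_ideal I R" "I \<noteq> carrier R"
  shows "I \<subseteq> J"
proof -
  define S where "S = {K. left_ideal K R \<and> K \<noteq> carrier R}"
  have "S \<subseteq> Pow (carrier R)"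
    using left_ideal_subset_carrier by (auto simp: S_def)
  then have "finite S"
    by (rule finite_subset) simp
  moreover have "I \<in> S"
    using assms by (simp add: S_def)
  ultimately have "\<exists>K\<in>S. I \<subseteq> K \<and> (\<forall>L\<in>S. K \<subseteq> L \<longrightarrow> K = L)"
    by (rule finite_has_maximal2)
  then obtain K where K: "K \<in> S" "I \<subseteq> K" and max: "\<forall>L\<in>S. K \<subseteq> L \<longrightarrow> K = L"
    by blast
  have "maximal_left_ideal K R"
    using K max unfolding maximal_left_ideal_def maximal_left_ideal_axioms_def S_def by blast
  then show ?thesis
    using K maximal_left_ideal_iff by blast
qed

text \<open>
  An element outside \<open>J\<close> generates the whole ring as a left ideal, so it has a left inverse. By
  finiteness a left inverse is two-sided.
\<close>

lemma Units_eq: "Units R = carrier R - J"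
proof (intro equalityI subsetI)
  fix a
  assume a: "a \<in> Units R"
  then show "a \<in> carrier R - J"
    using J_mult_left[of a "inv a"] one_notin_J Units_closed Units_inv_closed Units_l_inv
    by (metis DiffI)
next
  fix a
  assume a: "a \<in> carrier R - J"
  then have "a \<in> (\<lambda>r. r \<otimes> a) ` carrier R"
    by (intro image_eqI[of _ _ \<one>]) auto
  then have "(\<lambda>r. r \<otimes> a) ` carrier R = carrier R"
    using a proper_left_ideal_subset_J[OF left_ideal_principal[of a]] by blast
  then have "\<one> \<in> (\<lambda>r. r \<otimes> a) ` carrier R"
    by simp
  then obtain r where r: "r \<in> carrier R" "r \<otimes> a = \<one>"
    by force
  have "inj_on (\<lambda>b. a \<otimes> b) (carrier R)"
  proof (rule inj_onI)
    fix b c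
    assume bc: "b \<in> carrier R" "c \<in> carrier R" "a \<otimes> b = a \<otimes> c"
    then have "r \<otimes> a \<otimes> b = r \<otimes> a \<otimes> c"
      using a r(1) by (simp add: m_assoc)
    then show "b = c"
      using r bc by simp
  qed
  then have "(\<lambda>b. a \<otimes> b) ` carrier R = carrier R"
    using a by (intro endo_inj_surj) auto
  then have "\<one> \<in> (\<lambda>b. a \<otimes> b) ` carrier R"
    by simp
  then obtain b where b: "b \<in> carrier R" "a \<otimes> b = \<one>"
    by force
  have "b = r"
    using a b r m_assoc[of r a b] by auto
  then show "a \<in> Units R"
    using a b r by (auto simp: Units_def)
qed

lemma card_Units: "card (Units R) = card (carrier R) - card J"
  using J_subset by (simp add: Units_eq card_Diff_subset)

section \<open>Left annihilators in a local ring\<close>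

lemma finite_left_annihilator [simp]: "finite (left_annihilator b)"
  by (simp add: left_annihilator_def)

lemma left_annihilator_subset_J:
  assumes "b \<in> carrier R" "b \<noteq> \<zero>"
  shows "left_annihilator b \<subseteq> J"
proof (rule subsetI, rule ccontr)
  fix a
  assume a: "a \<in> left_annihilator b" "a \<notin> J"
  then have "a \<in> Units R" and "a \<otimes> b = \<zero>"
    by (auto simp: Units_eq left_annihilator_def)
  then have "inv a \<otimes> a \<otimes> b = \<zero>"
    using assms(1) Units_closed[of a] by (simp add: m_assoc del: Units_l_inv)
  then show False
    using \<open>a \<in> Units R\<close> assms by simp
qed

lemma principal_subset_J:
  assumes "b \<in> J"
  shows "(\<lambda>r. r \<otimes> b) ` carrier R \<subseteq> J"
  using assms J_mult_left by blast

text \<open>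
  A case of Nakayama's lemma: a nonzero element of \<open>J\<close> is not a left multiple of any of its
  products with elements of \<open>J\<close> on the left.
\<close>

lemma eq_zero_if_left_multiple:
  assumes "a \<in> J" "b \<in> J" "r \<in> carrier R" and eq: "b = r \<otimes> (a \<otimes> b)"
  shows "b = \<zero>"
proof -
  have c: "a \<in> carrier R" "b \<in> carrier R" "r \<otimes> a \<in> carrier R"
    using assms J_closed by auto
  have ra: "r \<otimes> a \<in> J"
    using assms J_mult_left by blast
  have "\<one> \<ominus> r \<otimes> a \<notin> J"
  proof
    assume "\<one> \<ominus> r \<otimes> a \<in> J"
    then have "(\<one> \<ominus> r \<otimes> a) \<oplus> r \<otimes> a \<in> J"
      using ra additive_subgroup.a_closed[OF additive_subgroup_J] by blast
    then show False
      using c one_notin_J by (simp add: minus_eq a_assoc l_neg)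
  qed
  moreover have "(\<one> \<ominus> r \<otimes> a) \<otimes> b = \<zero>"
  proof -
    have "(\<one> \<ominus> r \<otimes> a) \<otimes> b = b \<ominus> r \<otimes> (a \<otimes> b)"
      using c assms(3) by (simp add: minus_eq l_distr l_minus m_assoc)
    also have "\<dots> = \<zero>"
      unfolding eq[symmetric] using c by (simp add: minus_eq r_neg)
    finally show ?thesis .
  qed
  ultimately show ?thesis
    using c left_annihilator_subset_J[of b] by (auto simp: left_annihilator_def)
qed

section \<open>Counting factorizations\<close>

text \<open>The number of factorizations \<open>a \<otimes> b = x\<close> with both factors in \<open>J\<close>.\<close>

definition radical_count :: "'a \<Rightarrow> nat"
  where "radical_count x = card {(a, b) \<in> J \<times> J. a \<otimes> b = x}"

text \<open>
  If \<open>x \<in> J\<close>, then at most one factor of \<open>x = a \<otimes> b\<close> is a unit, and a unit factor on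
  a given side determines the other factor.
\<close>

lemma card_factorizations:
  assumes x: "x \<in> J"
  shows "card {(a, b) \<in> carrier R \<times> carrier R. a \<otimes> b = x}
    = 2 * (card (carrier R) - card J) + radical_count x"
proof -
  have xc: "x \<in> carrier R" and xU: "x \<notin> Units R"
    using x J_closed by (auto simp: Units_eq)
  define A where "A = (\<lambda>a. (a, inv a \<otimes> x)) ` Units R"
  define B where "B = (\<lambda>b. (x \<otimes> inv b, b)) ` Units R"
  define C where "C = {(a, b) \<in> J \<times> J. a \<otimes> b = x}"
  have finU: "finite (Units R)"
    by (simp add: Units_eq)
  have fin: "finite A" "finite B" "finite C"
    using finU finite_subset[of C "J \<times> J"] by (auto simp: A_def B_def C_def)
  have unit_left: "a \<otimes> (inv a \<otimes> x) = x" if "a \<in> Units R" for a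
    using that xc Units_closed[of a] by (simp add: m_assoc[symmetric])
  have unit_right: "x \<otimes> inv b \<otimes> b = x" if "b \<in> Units R" for b
    using that xc Units_closed[of b] by (simp add: m_assoc)
  have not_unit: "x \<otimes> inv b \<notin> Units R" if "b \<in> Units R" for b
  proof
    assume "x \<otimes> inv b \<in> Units R"
    then have "x \<otimes> inv b \<otimes> b \<in> Units R"
      using that by (rule Units_m_closed)
    then show False
      using unit_right[OF that] xU by simp
  qed
  have split: "{(a, b) \<in> carrier R \<times> carrier R. a \<otimes> b = x} = (A \<union> B) \<union> C"
  proof (intro equalityI subsetI)
    fix p
    assume "p \<in> {(a, b) \<in> carrier R \<times> carrier R. a \<otimes> b = x}"
    then obtain a b where p: "p = (a, b)" "a \<in> carrier R" "b \<in> carrier R" "a \<otimes> b = x"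
      by blast
    show "p \<in> (A \<union> B) \<union> C"
    proof (cases "a \<in> Units R")
      case True
      then have "b = inv a \<otimes> x"
        using p by (auto simp: m_assoc[symmetric])
      then show ?thesis
        using True p by (auto simp: A_def)
    next
      case aJ: False
      show ?thesis
      proof (cases "b \<in> Units R")
        case True
        then have "a = x \<otimes> inv b"
          using p by (auto simp: m_assoc)
        then show ?thesis
          using True p by (auto simp: B_def)
      next
        case False
        then show ?thesis
          using aJ p by (auto simp: C_def Units_eq)
      qed
    qed
  next
    fix p
    assume "p \<in> (A \<union> B) \<union> C"
    then show "p \<in> {(a, b) \<in> carrier R \<times> carrier R. a \<otimes> b = x}"
      using xc J_closed unit_left unit_right by (auto simp: A_def B_def C_def)
  qed
  have "A \<inter> B = {}"
    using not_unit by (auto simp: A_def B_def)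
  moreover have "(A \<union> B) \<inter> C = {}"
    by (auto simp: A_def B_def C_def Units_eq)
  ultimately have "card {(a, b) \<in> carrier R \<times> carrier R. a \<otimes> b = x} = card A + card B + card C"
    unfolding split using fin by (simp add: card_Un_disjoint)
  moreover have "card A = card (Units R)" "card B = card (Units R)"
    unfolding A_def B_def by (auto intro!: card_image inj_onI)
  ultimately show ?thesis
    by (simp add: card_Units radical_count_def C_def)
qed

lemma sum_radical_count: "(\<Sum>x\<in>J. radical_count x) = card J ^ 2"
proof -
  have "(\<lambda>(a, b). a \<otimes> b) ` (J \<times> J) \<subseteq> J"
    using J_mult_left J_closed by auto
  then have "(\<Sum>x\<in>J. card {p \<in> J \<times> J. (\<lambda>(a, b). a \<otimes> b) p = x}) = card (J \<times> J)"
    using sum.group[of "J \<times> J" J "\<lambda>(a, b). a \<otimes> b" "\<lambda>_. 1 :: nat"] by simp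
  moreover have "{p \<in> J \<times> J. (\<lambda>(a, b). a \<otimes> b) p = x} = {(a, b) \<in> J \<times> J. a \<otimes> b = x}" for x
    by auto
  ultimately show ?thesis
    by (simp add: radical_count_def power2_eq_square card_cartesian_product)
qed

text \<open>
  The summand \<open>card J\<close> comes from the second factor \<open>\<zero>\<close>. For any other second factor
  \<open>b\<close>, the whole annihilator of \<open>b\<close> lies in \<open>J\<close>.
\<close>

lemma radical_count_zero:
  "radical_count \<zero> = card J + (\<Sum>b\<in>J - {\<zero>}. card (left_annihilator b))"
proof -
  have "{(a, b) \<in> J \<times> J. a \<otimes> b = \<zero>} = prod.swap ` (SIGMA b:J. J \<inter> left_annihilator b)"
    using J_closed by (auto simp: left_annihilator_def)
  then have "radical_count \<zero> = card (SIGMA b:J. J \<inter> left_annihilator b)"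
    by (simp add: radical_count_def card_image)
  also have "\<dots> = (\<Sum>b\<in>J. card (J \<inter> left_annihilator b))"
    by (simp add: card_SigmaI)
  also have "\<dots> = card (J \<inter> left_annihilator \<zero>) + (\<Sum>b\<in>J - {\<zero>}. card (J \<inter> left_annihilator b))"
    by (simp add: sum.remove[of J \<zero>])
  also have "J \<inter> left_annihilator \<zero> = J"
    using J_subset by (auto simp: left_annihilator_def)
  also have "(\<Sum>b\<in>J - {\<zero>}. card (J \<inter> left_annihilator b))
      = (\<Sum>b\<in>J - {\<zero>}. card (left_annihilator b))"
    using left_annihilator_subset_J J_closed
    by (intro sum.cong) (auto simp: Int_absorb1)
  finally show ?thesis .
qed

end

section \<open>Radicals of index at most their order\<close>

text \<open>
  Here \<open>q\<close> is the order of the residue ring \<open>R / J\<close>. The inequality \<open>q \<le> card J\<close> excludes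
  the rings in which \<open>J\<close> is zero.
\<close>

locale finite_local_ring_index = finite_local_ring +
  fixes q :: nat
  assumes card_carrier: "card (carrier R) = q * card J"
    and q_ge_2: "q \<ge> 2"
    and q_le: "q \<le> card J"
begin

lemma card_J_ge_2: "card J \<ge> 2"
  using q_ge_2 q_le by simp

lemma J_nonzero_exists: "\<exists>x. x \<in> J - {\<zero>}"
proof (rule ccontr)
  assume "\<not> ?thesis"
  then have "card J \<le> card {\<zero>}"
    by (intro card_mono) auto
  then show False
    using card_J_ge_2 by simp
qed

lemma left_annihilator_ge:
  assumes "b \<in> J"
  shows "q \<le> card (left_annihilator b)"
proof -
  have "q * card J \<le> card J * card (left_annihilator b)"
    using card_principal_times_left_annihilator[OF finite_carrier J_closed[OF assms]]
      card_mono[OF finite_J principal_subset_J[OF assms]] card_carrier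
    by (metis mult_le_mono1)
  then show ?thesis
    using card_J_ge_2 by (simp add: mult.commute)
qed

lemma radical_count_zero_ge: "radical_count \<zero> \<ge> card J + (card J - 1) * q"
proof -
  have "(\<Sum>b\<in>J - {\<zero>}. q) \<le> (\<Sum>b\<in>J - {\<zero>}. card (left_annihilator b))"
    by (intro sum_mono left_annihilator_ge) auto
  then show ?thesis
    by (simp add: radical_count_zero)
qed

text \<open>
  Equality in the bound forces all annihilators of nonzero elements of \<open>J\<close> to have \<open>q\<close> elements, so each
  nonzero element of \<open>J\<close> generates \<open>J\<close> as a left ideal. By Nakayama, \<open>J\<close> is then contained in
  the annihilator of any such element.
\<close>

lemma card_J_if_radical_count_zero:
  assumes eq: "radical_count \<zero> = card J + (card J - 1) * q"
  shows "card J = q"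
proof -
  have "(\<Sum>b\<in>J - {\<zero>}. q) = (\<Sum>b\<in>J - {\<zero>}. card (left_annihilator b))"
    using eq by (simp add: radical_count_zero)
  then have ann: "q = card (left_annihilator b)" if "b \<in> J - {\<zero>}" for b
    using sum_mono_inv[of "\<lambda>_. q" "J - {\<zero>}" "\<lambda>b. card (left_annihilator b)" b]
      left_annihilator_ge that by auto
  have gen: "(\<lambda>r. r \<otimes> b) ` carrier R = J" if "b \<in> J - {\<zero>}" for b
  proof (rule card_subset_eq)
    show "card ((\<lambda>r. r \<otimes> b) ` carrier R) = card J"
      using card_principal_times_left_annihilator[OF finite_carrier, of b] ann[OF that] card_carrier that q_ge_2 J_closed
      by (metis DiffD1 mult.commute mult_cancel1 not_numeral_le_zero)
  qed (use that principal_subset_J in auto)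
  obtain b where b: "b \<in> J - {\<zero>}"
    using J_nonzero_exists by blast
  have "a \<otimes> b = \<zero>" if a: "a \<in> J" for a
  proof (rule ccontr)
    assume "a \<otimes> b \<noteq> \<zero>"
    then have "a \<otimes> b \<in> J - {\<zero>}"
      using a b J_closed J_mult_left by auto
    then have "b \<in> (\<lambda>r. r \<otimes> (a \<otimes> b)) ` carrier R"
      using gen b by simp
    then show False
      using eq_zero_if_left_multiple[OF a] b by blast
  qed
  then have "J \<subseteq> left_annihilator b"
    using J_closed by (auto simp: left_annihilator_def)
  then have "card J \<le> q"
    unfolding ann[OF b] by (intro card_mono) auto
  then show ?thesis
    using q_le by simp
qed

lemma mult_eq_zero_if_card_J:
  assumes "card J = q" "a \<in> J" "b \<in> J"
  shows "a \<otimes> b = \<zero>"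
proof (cases "b = \<zero>")
  case True
  then show ?thesis
    using assms J_closed by simp
next
  case False
  then have "left_annihilator b = J"
    using assms left_annihilator_ge left_annihilator_subset_J J_closed
    by (intro card_seteq) auto
  then show ?thesis
    using assms by (auto simp: left_annihilator_def)
qed

lemma radical_count_if_card_J:
  assumes "card J = q"
  shows "radical_count \<zero> = q ^ 2" and "x \<noteq> \<zero> \<Longrightarrow> radical_count x = 0"
proof -
  have *: "{(a, b) \<in> J \<times> J. a \<otimes> b = \<zero>} = J \<times> J"
    using mult_eq_zero_if_card_J[OF assms] by auto
  then show "radical_count \<zero> = q ^ 2"
    unfolding radical_count_def * using assms by (simp add: power2_eq_square card_cartesian_product)
  show "radical_count x = 0" if "x \<noteq> \<zero>"
  proof -
    have "{(a, b) \<in> J \<times> J. a \<otimes> b = x} = {}"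
      using mult_eq_zero_if_card_J[OF assms] that by auto
    then show ?thesis
      unfolding radical_count_def by (simp only: card.empty)
  qed
qed

lemma mult_prob_eq:
  assumes "x \<in> J"
  shows "mult_prob R x
    = (2 * (real q - 1) * real (card J) + real (radical_count x)) / (real q * real (card J)) ^ 2"
proof -
  have "card (carrier R) - card J = (q - 1) * card J"
    by (simp add: card_carrier diff_mult_distrib)
  then have "card {(a, b) \<in> carrier R \<times> carrier R. a \<otimes> b = x}
      = 2 * (q - 1) * card J + radical_count x"
    using card_factorizations[OF assms] by (simp only: mult.assoc)
  then show ?thesis
    using q_ge_2 by (simp add: mult_prob_def card_carrier of_nat_diff)
qed

text \<open>
  The three probability conditions, expressed by the numbers of factorizations inside \<open>J\<close> that
  they prescribe. In the first one the prescribed number is negative unless \<open>card J = q\<close>.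
\<close>

lemma radical_count_nonzero_iff_negative:
  "(\<forall>x \<in> J - {\<zero>}. real (radical_count x) = (real q - 1) * (real q - real (card J)))
    \<longleftrightarrow> card J = q" (is "?L \<longleftrightarrow> _")
proof
  assume ?L
  then obtain x where "real (radical_count x) = (real q - 1) * (real q - real (card J))"
    using J_nonzero_exists by blast
  then have "0 \<le> (real q - 1) * (real q - real (card J))"
    by (metis of_nat_0_le_iff)
  then have "real (card J) \<le> real q"
    using q_ge_2 by (simp add: zero_le_mult_iff)
  then show "card J = q"
    using q_le by simp
next
  assume "card J = q"
  then show ?L
    using radical_count_if_card_J(2) by simp
qed

text \<open>
  Here the prescribed numbers for nonzero \<open>x\<close> are so large that, for \<open>card J > q\<close>, they
  leave too few of the \<open>(card J)\<^sup>2\<close> products in \<open>J\<close> for \<open>\<zero>\<close>.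
\<close>

lemma radical_count_nonzero_iff_large:
  "(\<forall>x \<in> J - {\<zero>}. real (radical_count x) = real (card J) * (real (card J) - real q))
    \<longleftrightarrow> card J = q" (is "?L \<longleftrightarrow> _")
proof
  assume L: ?L
  define m where "m = real (card J)"
  have m: "m \<ge> 2" "m \<ge> real q"
    using card_J_ge_2 q_le by (auto simp: m_def)
  have "real (card J ^ 2) = real (radical_count \<zero>) + (\<Sum>x\<in>J - {\<zero>}. real (radical_count x))"
    unfolding sum_radical_count[symmetric] by (simp add: sum.remove[of J \<zero>])
  also have "(\<Sum>x\<in>J - {\<zero>}. real (radical_count x)) = (m - 1) * (m * (m - real q))"
    using L card_J_ge_2 by (simp add: m_def of_nat_diff)
  finally have "m ^ 2 = real (radical_count \<zero>) + (m - 1) * (m * (m - real q))"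
    by (simp add: m_def)
  moreover have "real (radical_count \<zero>) \<ge> m + (m - 1) * real q"
  proof -
    have "real (card J + (card J - 1) * q) \<le> real (radical_count \<zero>)"
      using radical_count_zero_ge by (simp only: of_nat_le_iff)
    then show ?thesis
      using card_J_ge_2 by (simp add: m_def of_nat_diff)
  qed
  moreover have "(m - 1) * real q > 0"
    using m q_ge_2 by simp
  ultimately have "m * ((m - 1) * (m - real q)) < m * (m - 1)"
    by (simp add: algebra_simps power2_eq_square)
  then have "m - real q < 1"
    using m by simp
  then have "card J < q + 1"
    by (simp add: m_def)
  then show "card J = q"
    using q_le by simp
next
  assume "card J = q"
  then show ?L
    using radical_count_if_card_J(2) by simp
qed

lemma radical_count_zero_iff:
  "real (radical_count \<zero>) = real (card J) + (real (card J) - 1) * real q \<longleftrightarrow> card J = q"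
    (is "?L \<longleftrightarrow> _")
proof
  assume ?L
  then have "real (radical_count \<zero>) = real (card J + (card J - 1) * q)"
    using card_J_ge_2 by (simp add: of_nat_diff)
  then show "card J = q"
    using card_J_if_radical_count_zero of_nat_eq_iff by blast
next
  assume "card J = q"
  then show ?L
    using radical_count_if_card_J(1) by (simp add: algebra_simps power2_eq_square)
qed

end

section \<open>The equivalence\<close>

theorem corollary4p3:
  fixes R :: "('a, 'm) ring_scheme" (structure)
    and F :: "('b, 'k) ring_scheme"
    and q n :: nat
  defines "J \<equiv> jacobson_radical R"
  assumes "local_ring R"
    and "finite (carrier R)"
    and "n \<ge> 2"
    and "card (carrier R) = q ^ n"
    and "field F"
    and "card (carrier F) = q"
    and "R Quot J \<simeq> F"
  shows
    "((\<forall>x \<in> J - {\<zero>}. mult_prob R x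
          = (real q - 1) * (real q ^ (n - 2) + 1) / real q ^ (2 * n - 1))
      \<longleftrightarrow> (\<forall>x \<in> J - {\<zero>}. mult_prob R x
          = (real q ^ (n - 1) + real q - 2) / real q ^ (n + 1)))
     \<and> ((\<forall>x \<in> J - {\<zero>}. mult_prob R x
          = (real q ^ (n - 1) + real q - 2) / real q ^ (n + 1))
      \<longleftrightarrow> mult_prob R \<zero>
          = (3 * real q ^ (n - 1) - real q ^ (n - 2) - 1) / real q ^ (2 * n - 1))
     \<and> (mult_prob R \<zero>
          = (3 * real q ^ (n - 1) - real q ^ (n - 2) - 1) / real q ^ (2 * n - 1)
      \<longleftrightarrow> card (carrier R) = q ^ 2)"
proof -
  obtain k where n: "n = k + 2"
    using \<open>n \<ge> 2\<close> by (metis add.commute le_Suc_ex)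
  interpret F: field F
    by (rule \<open>field F\<close>)
  interpret finite_local_ring R
    using assms by (simp add: finite_local_ring_def finite_local_ring_axioms_def)
  have "q \<noteq> 0"
  proof
    assume "q = 0"
    then have "card (carrier R) = 0"
      using assms n by simp
    then show False
      using finite_carrier zero_closed by auto
  qed
  then have "finite (carrier F)"
    using \<open>card (carrier F) = q\<close> card.infinite by fastforce
  then have "card {\<zero>\<^bsub>F\<^esub>, \<one>\<^bsub>F\<^esub>} \<le> card (carrier F)"
    by (intro card_mono) auto
  then have q2: "q \<ge> 2"
    using \<open>card (carrier F) = q\<close> by simp
  have "card (a_rcosets J) = q"
    using \<open>R Quot J \<simeq> F\<close> \<open>card (carrier F) = q\<close> bij_betw_same_card
    unfolding is_ring_iso_def ring_iso_def FactRing_def by fastforce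
  then have index: "card (carrier R) = q * card J"
    using a_lagrange[OF finite_carrier additive_subgroup_J] by (simp add: J_def order_def)
  then have cardJ: "card J = q ^ (k + 1)"
    using assms n q2 by simp
  then have "q \<le> card J"
    using q2 by simp
  then interpret finite_local_ring_index R q
    using index q2 by unfold_locales (simp_all add: J_def)
  \<comment> \<open>Then \<open>|R| = Q\<^sup>2 P\<close> and \<open>|J| = Q P\<close>, which removes the truncated exponents.\<close>
  define Q where "Q = real q"
  define P where "P = Q ^ k"
  have Q: "Q \<ge> 2" and P: "P > 0"
    using q2 by (auto simp: Q_def P_def)
  have m: "real (card J) = Q * P"
    by (simp add: cardJ Q_def P_def)
  have powers: "Q ^ (n - 2) = P" "Q ^ (n - 1) = Q * P" "Q ^ (n + 1) = Q ^ 3 * P"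
      "Q ^ (2 * n - 1) = Q ^ 3 * P ^ 2"
    by (simp_all add: n P_def power_add power_mult power2_eq_square power3_eq_cube mult_2)
  have prob: "mult_prob R x = (2 * (Q - 1) * (Q * P) + real (radical_count x)) / (Q * (Q * P)) ^ 2"
    if "x \<in> J" for x
    using mult_prob_eq[of x] that m by (simp add: J_def Q_def)
  have i1: "(\<forall>x \<in> J - {\<zero>}. mult_prob R x
      = (real q - 1) * (real q ^ (n - 2) + 1) / real q ^ (2 * n - 1)) \<longleftrightarrow> card J = q"
  proof -
    have "mult_prob R x = (Q - 1) * (Q ^ (n - 2) + 1) / Q ^ (2 * n - 1)
        \<longleftrightarrow> real (radical_count x) = (Q - 1) * (Q - Q * P)" if "x \<in> J - {\<zero>}" for x
    proof -
      have "(Q - 1) * (Q ^ (n - 2) + 1) / Q ^ (2 * n - 1)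
          = (Q * (Q - 1) * (P + 1)) / (Q * (Q * P)) ^ 2"
        unfolding powers using P Q by (simp add: field_simps power2_eq_square power3_eq_cube)
      then have "mult_prob R x = (Q - 1) * (Q ^ (n - 2) + 1) / Q ^ (2 * n - 1)
          \<longleftrightarrow> 2 * (Q - 1) * (Q * P) + real (radical_count x) = Q * (Q - 1) * (P + 1)"
        using prob that P Q by simp
      then show ?thesis
        by (auto simp: algebra_simps)
    qed
    then show ?thesis
      using radical_count_nonzero_iff_negative m by (simp add: J_def Q_def)
  qed
  have i2: "(\<forall>x \<in> J - {\<zero>}. mult_prob R x
      = (real q ^ (n - 1) + real q - 2) / real q ^ (n + 1)) \<longleftrightarrow> card J = q"
  proof -
    have "mult_prob R x = (Q ^ (n - 1) + Q - 2) / Q ^ (n + 1)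
        \<longleftrightarrow> real (radical_count x) = Q * P * (Q * P - Q)" if "x \<in> J - {\<zero>}" for x
    proof -
      have "(Q ^ (n - 1) + Q - 2) / Q ^ (n + 1)
          = (Q * P * (Q * P + Q - 2)) / (Q * (Q * P)) ^ 2"
        unfolding powers using P Q by (simp add: field_simps power2_eq_square power3_eq_cube)
      then have "mult_prob R x = (Q ^ (n - 1) + Q - 2) / Q ^ (n + 1)
          \<longleftrightarrow> 2 * (Q - 1) * (Q * P) + real (radical_count x) = Q * P * (Q * P + Q - 2)"
        using prob that P Q by simp
      then show ?thesis
        by (auto simp: algebra_simps)
    qed
    then show ?thesis
      using radical_count_nonzero_iff_large m by (simp add: J_def Q_def)
  qed
  have i3: "mult_prob R \<zero>
      = (3 * real q ^ (n - 1) - real q ^ (n - 2) - 1) / real q ^ (2 * n - 1) \<longleftrightarrow> card J = q"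
  proof -
    have "(3 * Q ^ (n - 1) - Q ^ (n - 2) - 1) / Q ^ (2 * n - 1)
        = (Q * (3 * (Q * P) - P - 1)) / (Q * (Q * P)) ^ 2"
      unfolding powers using P Q by (simp add: field_simps power2_eq_square power3_eq_cube)
    then have "mult_prob R \<zero> = (3 * Q ^ (n - 1) - Q ^ (n - 2) - 1) / Q ^ (2 * n - 1)
        \<longleftrightarrow> 2 * (Q - 1) * (Q * P) + real (radical_count \<zero>) = Q * (3 * (Q * P) - P - 1)"
      using prob[of \<zero>] P Q by (simp add: J_def)
    also have "\<dots> \<longleftrightarrow> real (radical_count \<zero>) = Q * P + (Q * P - 1) * Q"
      by (auto simp: algebra_simps)
    finally show ?thesis
      using radical_count_zero_iff m by (simp add: J_def Q_def)
  qed
  have "card (carrier R) = q ^ 2 \<longleftrightarrow> card J = q"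
    using index q2 by (auto simp: power2_eq_square)
  then show ?thesis
    using i1 i2 i3 by blast
qed

end
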